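(* Let $f(z)=\sum_{n=0}^{\infty} a_n z^n\in\mathcal{B}$, let $\omega\in\mathcal{B}_m$ for some $m\in\mathbb{N}$, let $p\in(0,2]$, and let $\varphi=\{\varphi_n(r)\}_{n=0}^{\infty}\in\mathcal{F}$. For $z\in\mathbb{D}$ with $|z|=r$ define $$A_f(z):=|f(\omega(z))|^p\varphi_0(r)+B_1(f,\varphi,r)+A(f_0,\varphi,r),$$ and for $r\in[0,1)$ define $$\Psi_1(r)=p\left(\frac{1-r^m}{1+r^m}\right)\varphi_0(r)-2\Phi_1(r).$$ Let $R_1:=R_1(m,p)$ be the minimal positive root in $(0,1)$ of the equation $\Psi_1(r)=0$. If $\Psi_1(r)\geq 0$ for $0\le r\le R_1$, then $$A_f(z)\le\varphi_0(r)\quad\text{for } |z|=r\le R_1.$$ Moreover, in the case when $\Psi_1(r)<0$ in some interval $(R_1,R_1+\varepsilon)$ with $\varepsilon>0$, the number $R_1$ cannot be improved.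
   Context: $\mathbb{D}=\{z\in\mathbb{C}:|z|<1\}$ and $\mathbb{N}=\{1,2,\ldots\}$. $\mathcal{B}$ is the set of analytic functions $f$ on $\mathbb{D}$ with $\sup_{z\in\mathbb{D}}|f(z)|\le 1$. For $m\in\mathbb{N}$, $\mathcal{B}_m=\{\omega\in\mathcal{B}:\omega(0)=\cdots=\omega^{(m-1)}(0)=0,\ \omega^{(m)}(0)\ne0\}$. $\mathcal{F}$ is the set of all sequences $\varphi=\{\varphi_n(r)\}_{n=0}^\infty$ of nonnegative continuous functions on $[0,1)$ such that $\sum_{n=0}^\infty\varphi_n(r)$ converges locally uniformly on $[0,1)$. For $\varphi\in\mathcal{F}$ put $\Phi_N(r)=\sum_{n=N}^\infty\varphi_n(r)$. For $f(z)=\sum_{n=0}^\infty a_nz^n\in\mathcal{B}$ put $f_0(z)=f(z)-f(0)$, $$B_1(f,\varphi,r)=\sum_{n=1}^\infty|a_n|\varphi_n(r),\qquad A(f_0,\varphi,r)=\sum_{n=1}^\infty|a_n|^2\left[\frac{\varphi_{2n}(r)}{1+|a_0|}+\Phi_{2n+1}(r)\right].$$ "The number $R_1$ cannot be improved" means that, for the given $m,p,\varphi$, $R_1$ cannot be replaced by a larger number: for every $R'\in(R_1,1]$ there exist $f\in\mathcal{B}$, $\omega\in\mathcal{B}_m$ and $z$ with $|z|=r<R'$ such that $A_f(z)>\varphi_0(r)$. *)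

theory Defs
  imports "HOL-Complex_Analysis.Complex_Analysis"
begin

abbreviation unit_disc :: "complex set" where
  "unit_disc \<equiv> ball 0 1"

definition class_B :: "(complex \<Rightarrow> complex) set" where
  "class_B = {f. f analytic_on unit_disc \<and> (\<forall>z\<in>unit_disc. norm (f z) \<le> 1)}"

definition class_Bm :: "nat \<Rightarrow> (complex \<Rightarrow> complex) set" where
  "class_Bm m = {\<omega> \<in> class_B. (\<forall>k<m. (deriv ^^ k) \<omega> 0 = 0) \<and> (deriv ^^ m) \<omega> 0 \<noteq> 0}"

definition taylor_coeff :: "(complex \<Rightarrow> complex) \<Rightarrow> nat \<Rightarrow> complex" where
  "taylor_coeff f n = fps_nth (fps_expansion f 0) n"

text \<open>Local uniform convergence on \<open>[0,1)\<close>: every point has a relative neighbourhood on which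
  the partial sums converge uniformly. The values of the functions outside \<open>[0,1)\<close> are
  irrelevant.\<close>

definition class_F :: "(nat \<Rightarrow> real \<Rightarrow> real) set" where
  "class_F = {\<phi>.
     (\<forall>n. continuous_on {0..<1} (\<phi> n) \<and> (\<forall>r\<in>{0..<1}. 0 \<le> \<phi> n r)) \<and>
     (\<forall>x\<in>{0..<1}. \<exists>d>0.
        uniformly_convergent_on (ball x d \<inter> {0..<1}) (\<lambda>N r. \<Sum>n<N. \<phi> n r))}"

definition tail_sum :: "(nat \<Rightarrow> real \<Rightarrow> real) \<Rightarrow> nat \<Rightarrow> real \<Rightarrow> real" where
  "tail_sum \<phi> N r = (\<Sum>n. \<phi> (n + N) r)"

text \<open>Series starting at \<open>n = 1\<close> are written with \<open>Suc n\<close> in place of \<open>n\<close>.\<close>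

definition B1_sum ::
  "(complex \<Rightarrow> complex) \<Rightarrow> (nat \<Rightarrow> real \<Rightarrow> real) \<Rightarrow> real \<Rightarrow> real" where
  "B1_sum f \<phi> r = (\<Sum>n. norm (taylor_coeff f (Suc n)) * \<phi> (Suc n) r)"

text \<open>This is \<open>A(f\<^sub>0, \<phi>, r)\<close> with \<open>f\<^sub>0 = f - f(0)\<close>; it is a function of \<open>f\<close> since it
  involves the constant coefficient of \<open>f\<close>, and the other coefficients of \<open>f\<close> and \<open>f\<^sub>0\<close>
  agree.\<close>

definition A_sum ::
  "(complex \<Rightarrow> complex) \<Rightarrow> (nat \<Rightarrow> real \<Rightarrow> real) \<Rightarrow> real \<Rightarrow> real" where
  "A_sum f \<phi> r =
     (\<Sum>n. (norm (taylor_coeff f (Suc n)))\<^sup>2 *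
        (\<phi> (2 * Suc n) r / (1 + norm (taylor_coeff f 0)) + tail_sum \<phi> (2 * Suc n + 1) r))"

definition A_fun ::
  "(complex \<Rightarrow> complex) \<Rightarrow> (complex \<Rightarrow> complex) \<Rightarrow> real \<Rightarrow> (nat \<Rightarrow> real \<Rightarrow> real) \<Rightarrow> complex \<Rightarrow> real"
where
  "A_fun f \<omega> p \<phi> z =
     norm (f (\<omega> z)) powr p * \<phi> 0 (norm z) + B1_sum f \<phi> (norm z) + A_sum f \<phi> (norm z)"

definition Psi1 :: "nat \<Rightarrow> real \<Rightarrow> (nat \<Rightarrow> real \<Rightarrow> real) \<Rightarrow> real \<Rightarrow> real" where
  "Psi1 m p \<phi> r = p * ((1 - r ^ m) / (1 + r ^ m)) * \<phi> 0 r - 2 * tail_sum \<phi> 1 r"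

definition minimal_positive_root :: "(real \<Rightarrow> real) \<Rightarrow> real \<Rightarrow> bool" where
  "minimal_positive_root g R \<longleftrightarrow>
     R \<in> {0<..<1} \<and> g R = 0 \<and> (\<forall>r\<in>{0<..<1}. g r = 0 \<longrightarrow> R \<le> r)"

end

theory Submission
  imports Defs
begin

text \<open>
  If \<open>f \<in> \<B>\<close> and \<open>X\<close> is a polynomial, then comparing means over circles shows that no Taylor
  coefficient of \<open>f X\<^sup>2\<close> exceeds in modulus the sum of the squared moduli of the coefficients of \<open>X\<close>. Taking
  \<open>X = 1 + u H\<close> with \<open>\<bar>u\<bar> = 1\<close>, where \<open>H\<close> is the conjugate of the first half of \<open>f\<close> read backwards
  (its middle coefficient scaled by \<open>1 / (1 + \<bar>a\<^sub>0\<bar>)\<close> when \<open>N\<close> is even), gives Carlson's inequalities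
  \<open>\<bar>a\<^sub>N\<bar> \<le> 1 - \<Sum>\<^sub>k\<^sub>\<le>\<^sub>n \<bar>a\<^sub>k\<bar>\<^sup>2\<close> for \<open>N = 2n + 1\<close> and
  \<open>\<bar>a\<^sub>N\<bar> \<le> 1 - \<Sum>\<^sub>k\<^sub><\<^sub>n \<bar>a\<^sub>k\<bar>\<^sup>2 - \<bar>a\<^sub>n\<bar>\<^sup>2 / (1 + \<bar>a\<^sub>0\<bar>)\<close> for \<open>N = 2n\<close>.
  Multiplied by \<open>\<phi>\<^sub>N(r)\<close> and summed over \<open>N\<close> they yield \<open>B\<^sub>1 + A \<le> (1 - \<bar>a\<^sub>0\<bar>\<^sup>2) \<Phi>\<^sub>1(r)\<close>.
  On the other hand \<open>1 - t\<^sup>p \<ge> (p/2) (1 - t\<^sup>2)\<close>, which together with the lemmas of Schwarz and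
  Schwarz--Pick bounds \<open>1 - \<bar>f(\<omega>(z))\<bar>\<^sup>p\<close> below by
  \<open>(p/2) (1 - \<bar>a\<^sub>0\<bar>\<^sup>2) (1 - r\<^sup>m) / (1 + r\<^sup>m)\<close>.
  For sharpness take \<open>f(z) = (z - a) / (1 - a z)\<close> and \<open>\<omega>(z) = - z\<^sup>m\<close>: at \<open>z = r\<close> the first-order
  behaviour of \<open>A\<^sub>f(r) - \<phi>\<^sub>0(r)\<close> as \<open>a \<rightarrow> 1\<close> is \<open>- (1 - a) \<Psi>\<^sub>1(r)\<close>.
\<close>

subsection \<open>Carlson's inequalities\<close>

text \<open>Orthogonality of characters: the integrand is exp(c t) with c an integer multiple of 2
  pi i. For c = 0 it is 1; otherwise the primitive exp(c t) / c agrees at both endpoints.\<close>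

lemma circle_character_integral:
  fixes i j :: nat
  shows "((\<lambda>t. exp (2 * of_real pi * \<i> * of_real t) ^ i * cnj (exp (2 * of_real pi * \<i> * of_real t)) ^ j)
            has_integral (if i = j then 1 else 0)) {0..1}"
proof -
  define c :: complex where "c = 2 * of_real pi * \<i> * (of_nat i - of_nat j)"
  have eq: "exp (2 * of_real pi * \<i> * of_real t) ^ i * cnj (exp (2 * of_real pi * \<i> * of_real t)) ^ j
      = exp (c * of_real t)" for t :: real
    by (simp add: c_def exp_cnj flip: exp_of_nat_mult exp_add) (simp add: algebra_simps)
  show ?thesis
  proof (cases "i = j")
    case True
    then show ?thesis
      unfolding eq using has_integral_const_real[of "1::complex" 0 1] by (simp add: c_def)
  next
    case False
    hence c: "c \<noteq> 0" by (simp add: c_def)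
    have "((\<lambda>t. exp (c * of_real t)) has_integral
            exp (c * of_real 1) / c - exp (c * of_real 0) / c) {0..1}"
    proof (rule fundamental_theorem_of_calculus)
      fix t :: real
      have "((\<lambda>z. exp (c * z) / c) has_field_derivative exp (c * of_real t)) (at (of_real t))"
        using c by (auto intro!: derivative_eq_intros)
      thus "((\<lambda>t. exp (c * of_real t) / c) has_vector_derivative exp (c * of_real t))
          (at t within {0..1})"
        by (rule has_vector_derivative_real_field)
    qed simp
    moreover have "exp c = 1"
      unfolding exp_eq_1 c_def
      by (auto simp: intro!: exI[of _ "int i - int j"])
    ultimately show ?thesis unfolding eq using False by simp
  qed
qed

text \<open>Parseval's identity for a polynomial on the circle of radius \<rho>: in the expanded
  square only the diagonal terms have nonzero mean.\<close>

lemma circle_mean_square: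
  fixes x :: "nat \<Rightarrow> complex" and \<rho> :: real
  shows "((\<lambda>t. (norm (\<Sum>i\<le>d. x i * (of_real \<rho> * exp (2 * of_real pi * \<i> * of_real t)) ^ i))\<^sup>2)
            has_integral (\<Sum>i\<le>d. (norm (x i))\<^sup>2 * \<rho> ^ (2 * i))) {0..1}"
proof -
  let ?e = "\<lambda>t::real. exp (2 * of_real pi * \<i> * of_real t)"
  let ?X = "\<lambda>t. \<Sum>i\<le>d. x i * (of_real \<rho> * ?e t) ^ i"
  have eq: "complex_of_real ((norm (?X t))\<^sup>2) =
      (\<Sum>i\<le>d. \<Sum>j\<le>d. (x i * cnj (x j) * of_real \<rho> ^ (i + j)) * (?e t ^ i * cnj (?e t) ^ j))" for t
    unfolding complex_norm_square
    by (simp add: sum_product power_mult_distrib power_add mult_ac)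
  have "((\<lambda>t. complex_of_real ((norm (?X t))\<^sup>2)) has_integral
     (\<Sum>i\<le>d. \<Sum>j\<le>d. (x i * cnj (x j) * of_real \<rho> ^ (i + j)) * (if i = j then 1 else 0))) {0..1}"
    unfolding eq
    by (intro has_integral_sum finite_atMost has_integral_mult_right circle_character_integral)
  also have "(\<Sum>i\<le>d. \<Sum>j\<le>d. (x i * cnj (x j) * complex_of_real \<rho> ^ (i + j)) * (if i = j then 1 else 0))
      = complex_of_real (\<Sum>i\<le>d. (norm (x i))\<^sup>2 * \<rho> ^ (2 * i))"
    unfolding of_real_sum
  proof (rule sum.cong)
    fix i assume "i \<in> {..d}"
    hence "(\<Sum>j\<le>d. (x i * cnj (x j) * complex_of_real \<rho> ^ (i + j)) * (if i = j then 1 else 0))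
        = (\<Sum>j\<in>{i}. (x i * cnj (x j) * complex_of_real \<rho> ^ (i + j)) * (if i = j then 1 else 0))"
      by (intro sum.mono_neutral_right) auto
    also have "\<dots> = of_real ((norm (x i))\<^sup>2) * of_real (\<rho> ^ (2 * i))"
      unfolding complex_norm_square by (simp add: mult_2)
    finally show "(\<Sum>j\<le>d. (x i * cnj (x j) * complex_of_real \<rho> ^ (i + j)) * (if i = j then 1 else 0))
        = of_real ((norm (x i))\<^sup>2 * \<rho> ^ (2 * i))" by simp
  qed simp
  finally show ?thesis
    by (drule_tac has_integral_Re) simp 
qed

text \<open>Cauchy's coefficient formula on the circle of radius \<rho>. Scaled by
  \<open>\<rho> ^ N / (2 * pi * \<i>)\<close>, its integrand becomes \<open>G\<close> divided by a
  unimodular factor, which \<open>g\<close> dominates.\<close>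

lemma norm_higher_deriv_le_circle_mean:
  fixes G :: "complex \<Rightarrow> complex"
  assumes hol: "G holomorphic_on ball 0 1" and \<rho>: "0 < \<rho>" "\<rho> < 1"
    and bnd: "\<And>t. norm (G (of_real \<rho> * exp (2 * of_real pi * \<i> * of_real t))) \<le> g t"
    and int: "(g has_integral I) {0..1}"
  shows "norm ((deriv ^^ N) G 0 / fact N) * \<rho> ^ N \<le> I"
proof -
  let ?e = "\<lambda>t::real. exp (2 * of_real pi * \<i> * of_real t)"
  let ?c = "(deriv ^^ N) G 0 / fact N"
  have "((\<lambda>u. G u / (u - 0) ^ Suc N) has_contour_integral
      ((2 * pi * \<i>) / fact N * (deriv ^^ N) G 0)) (circlepath 0 \<rho>)"
  proof (rule Cauchy_has_contour_integral_higher_derivative_circlepath)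
    have "cball 0 \<rho> \<subseteq> ball (0::complex) 1" using \<rho> by auto
    with hol show "continuous_on (cball 0 \<rho>) G"
      by (meson continuous_on_subset holomorphic_on_imp_continuous_on)
    show "G holomorphic_on ball 0 \<rho>"
      using hol by (rule holomorphic_on_subset) (use \<rho> in auto)
  qed (use \<rho> in auto)
  hence "((\<lambda>t. G (\<rho> * ?e t) / (\<rho> * ?e t) ^ Suc N * (2 * pi * \<i> * \<rho> * ?e t)) has_integral
      (2 * pi * \<i> * ?c)) {0..1}"
    unfolding has_contour_integral vector_derivative_circlepath by (simp add: circlepath)
  hence "((\<lambda>t. (\<rho> ^ N / (2 * pi * \<i>)) * (G (\<rho> * ?e t) / (\<rho> * ?e t) ^ Suc N * (2 * pi * \<i> * \<rho> * ?e t)))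
      has_integral (\<rho> ^ N / (2 * pi * \<i>)) * (2 * pi * \<i> * ?c)) {0..1}"
    by (rule has_integral_mult_right)
  also have "(\<lambda>t. (\<rho> ^ N / (2 * pi * \<i>)) * (G (\<rho> * ?e t) / (\<rho> * ?e t) ^ Suc N * (2 * pi * \<i> * \<rho> * ?e t)))
      = (\<lambda>t. G (\<rho> * ?e t) / ?e t ^ N)"
    using \<rho> by (intro ext) (simp add: field_simps power_mult_distrib)
  also have "(\<rho> ^ N / (2 * pi * \<i>)) * (2 * pi * \<i> * ?c) = \<rho> ^ N * ?c"
    by (simp add: field_simps)
  finally have "norm (\<rho> ^ N * ?c) \<le> I \<bullet> 1"
    by (rule has_integral_norm_bound_integral_component[OF _ int])
       (use bnd in \<open>simp add: norm_divide norm_power\<close>)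
  thus ?thesis using \<rho> by (simp add: norm_mult norm_power norm_divide mult.commute)
qed

lemma class_B_holomorphic: "f \<in> class_B \<Longrightarrow> f holomorphic_on unit_disc"
  by (simp add: class_B_def analytic_imp_holomorphic)

lemma class_B_norm_le: "f \<in> class_B \<Longrightarrow> norm z < 1 \<Longrightarrow> norm (f z) \<le> 1"
  by (simp add: class_B_def)

lemma class_B_has_fps_expansion:
  assumes "f \<in> class_B"
  shows "f has_fps_expansion Abs_fps (taylor_coeff f)"
proof -
  have "f has_fps_expansion fps_expansion f 0"
    using assms by (intro has_fps_expansion_fps_expansion[of unit_disc]) (auto simp: class_B_holomorphic)
  also have "fps_expansion f 0 = Abs_fps (taylor_coeff f)"
    by (simp add: fps_eq_iff taylor_coeff_def)
  finally show ?thesis .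
qed

lemma taylor_coeff_0: "taylor_coeff f 0 = f 0"
  by (simp add: taylor_coeff_def fps_expansion_def)

text \<open>Compare the circle means of \<open>|f X\<^sup>2|\<close> and \<open>|X|\<^sup>2\<close>.\<close>

lemma class_B_norm_coeff_mult_square_le:
  fixes x :: "nat \<Rightarrow> complex" and d :: nat
  assumes f: "f \<in> class_B"
  defines "X \<equiv> Abs_fps (\<lambda>i. if i \<le> d then x i else 0)"
  shows "norm (fps_nth (Abs_fps (taylor_coeff f) * X\<^sup>2) N) \<le> (\<Sum>i\<le>d. (norm (x i))\<^sup>2)"
proof -
  let ?e = "\<lambda>t::real. exp (2 * of_real pi * \<i> * of_real t)"
  define P where "P z = (\<Sum>i\<le>d. x i * z ^ i)" for z
  have "(\<lambda>n. fps_nth X n * z ^ n) sums P z" for z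
    using sums_If_finite_set[of "{..d}" "\<lambda>n. x n * z ^ n"]
    by (simp add: X_def P_def if_distrib[of "\<lambda>c. c * _"] cong: if_cong)
  hence "P has_fps_expansion X"
    by (intro has_fps_expansionI) auto
  hence "(\<lambda>z. f z * (P z)\<^sup>2) has_fps_expansion (Abs_fps (taylor_coeff f) * X\<^sup>2)"
    unfolding power2_eq_square by (intro has_fps_expansion_mult class_B_has_fps_expansion f)
  hence nth: "fps_nth (Abs_fps (taylor_coeff f) * X\<^sup>2) N = (deriv ^^ N) (\<lambda>z. f z * (P z)\<^sup>2) 0 / fact N"
    by (rule fps_nth_fps_expansion)
  let ?c = "norm (fps_nth (Abs_fps (taylor_coeff f) * X\<^sup>2) N)"
  have le: "?c * \<rho> ^ N \<le> (\<Sum>i\<le>d. (norm (x i))\<^sup>2)" if \<rho>: "0 < \<rho>" "\<rho> < 1" for \<rho> :: real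
  proof -
    have "?c * \<rho> ^ N \<le> (\<Sum>i\<le>d. (norm (x i))\<^sup>2 * \<rho> ^ (2 * i))"
      unfolding nth
    proof (rule norm_higher_deriv_le_circle_mean[OF _ \<rho> _ circle_mean_square])
      show "(\<lambda>z. f z * (P z)\<^sup>2) holomorphic_on ball 0 1"
        unfolding P_def by (intro holomorphic_intros class_B_holomorphic f)
      fix t
      have "norm (f (\<rho> * ?e t)) * (norm (P (\<rho> * ?e t)))\<^sup>2 \<le> 1 * (norm (P (\<rho> * ?e t)))\<^sup>2"
        using \<rho> by (intro mult_right_mono class_B_norm_le f) (auto simp: norm_mult)
      thus "norm (f (\<rho> * ?e t) * (P (\<rho> * ?e t))\<^sup>2)
          \<le> (norm (\<Sum>i\<le>d. x i * (of_real \<rho> * ?e t) ^ i))\<^sup>2"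
        by (simp add: norm_mult norm_power P_def)
    qed
    also have "\<dots> \<le> (\<Sum>i\<le>d. (norm (x i))\<^sup>2 * 1)"
      using \<rho> by (intro sum_mono mult_left_mono power_le_one) auto
    finally show ?thesis by simp
  qed
  \<comment> \<open>The right-hand side of \<open>le\<close> is free of \<rho>, so letting \<rho>
    tend to 1 removes the factor \<open>\<rho> ^ N\<close>.\<close>
  have "((\<lambda>\<rho>. ?c * \<rho> ^ N) \<longlongrightarrow> ?c * 1 ^ N) (at_left 1)"
    by (intro tendsto_intros)
  moreover have "eventually (\<lambda>\<rho>. ?c * \<rho> ^ N \<le> (\<Sum>i\<le>d. (norm (x i))\<^sup>2)) (at_left (1::real))"
    using eventually_at_left_real[of 0 "1::real", OF zero_less_one] by (rule eventually_mono) (auto intro: le)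
  ultimately have "?c * 1 ^ N \<le> (\<Sum>i\<le>d. (norm (x i))\<^sup>2)"
    by (intro tendsto_upperbound) auto
  thus ?thesis by simp
qed

text \<open>The test polynomial is \<open>1 + u (w\<^sub>0 z\<^sup>N + \<dots> + w\<^sub>n z\<^bsup>N-n\<^esup>)\<close>.\<close>

lemma class_B_coeff_test_bound:
  assumes f: "f \<in> class_B" and N: "2 * n \<le> N" "1 \<le> N" and u: "norm u = 1"
  defines "a \<equiv> taylor_coeff f"
  shows "norm (a N + 2 * u * (\<Sum>k\<le>n. a k * w k) + (if N = 2 * n then u\<^sup>2 * a 0 * (w n)\<^sup>2 else 0))
    \<le> 1 + (\<Sum>k\<le>n. (norm (w k))\<^sup>2)"
proof -
  \<comment> \<open>\<open>x\<close> lists the coefficients of the test polynomial. \<open>G\<close>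
    is its nonconstant part with u and the power of z of exponent N - n divided out, so that the
    square can be expanded as formal power series.\<close>
  define x where "x i = (if i = 0 then 1 else if N - n \<le> i then u * w (N - i) else 0)" for i
  define G where "G = Abs_fps (\<lambda>i. if i \<le> n then w (n - i) else 0)"
  let ?F = "Abs_fps a"
  let ?X = "Abs_fps (\<lambda>i. if i \<le> N then x i else 0)"
  have nN: "0 < N - n" "n \<le> N" using N by auto
  have X: "?X = 1 + fps_const u * (fps_X ^ (N - n) * G)"
    using nN by (auto simp: fps_eq_iff x_def G_def fps_X_power_mult_nth)
  have "?F * ?X\<^sup>2 = ?F + fps_const (2 * u) * (fps_X ^ (N - n) * (?F * G))
      + fps_const (u\<^sup>2) * (fps_X ^ (2 * (N - n)) * (?F * G\<^sup>2))"
  proof -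
    have "A * (1 + U * (Y * G))\<^sup>2 = A + (2 * U) * (Y * (A * G)) + U\<^sup>2 * (Y\<^sup>2 * (A * G\<^sup>2))"
      for A U Y :: "complex fps"
      by algebra
    from this[of ?F "fps_const u" "fps_X ^ (N - n)"] show ?thesis
      unfolding X by (simp add: fps_const_power mult.commute flip: power_mult fps_const_mult fps_numeral_fps_const)
  qed
  hence "fps_nth (?F * ?X\<^sup>2) N = a N + 2 * u * (if N < N - n then 0 else fps_nth (?F * G) (N - (N - n)))
      + u\<^sup>2 * (if N < 2 * (N - n) then 0 else fps_nth (?F * G\<^sup>2) (N - 2 * (N - n)))"
    by (simp only: fps_add_nth fps_mult_left_const_nth fps_X_power_mult_nth fps_nth_Abs_fps)
  also have "fps_nth (?F * G) (N - (N - n)) = (\<Sum>k\<le>n. a k * w k)"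
    using nN by (auto simp: fps_mult_nth G_def atLeast0AtMost intro!: sum.cong)
  \<comment> \<open>From 2n \<le> N it follows that 2(N - n) \<ge> N, so the quadratic term reaches
    degree N only if N = 2n, and then only through its constant coefficient.\<close>
  also have "(if N < 2 * (N - n) then 0 else fps_nth (?F * G\<^sup>2) (N - 2 * (N - n)))
     = (if N = 2 * n then a 0 * (w n)\<^sup>2 else 0)"
    using N by (auto simp: power2_eq_square G_def)
  finally have nth: "fps_nth (?F * ?X\<^sup>2) N = a N + 2 * u * (\<Sum>k\<le>n. a k * w k)
      + (if N = 2 * n then u\<^sup>2 * a 0 * (w n)\<^sup>2 else 0)"
    using nN by auto
  have "(\<Sum>i\<le>N. (norm (x i))\<^sup>2) = (\<Sum>i\<in>insert 0 {N-n..N}. (norm (x i))\<^sup>2)"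
    by (rule sum.mono_neutral_right) (auto simp: x_def)
  also have "\<dots> = 1 + (\<Sum>i=N-n..N. (norm (w (N - i)))\<^sup>2)"
    using nN u by (auto simp: x_def norm_mult intro!: sum.cong)
  also have "(\<Sum>i=N-n..N. (norm (w (N - i)))\<^sup>2) = (\<Sum>k\<le>n. (norm (w k))\<^sup>2)"
    using nN by (intro sum.reindex_bij_witness[of _ "\<lambda>k. N - k" "\<lambda>i. N - i"]) auto
  finally show ?thesis
    using class_B_norm_coeff_mult_square_le[OF f, of N x N] nth by (simp add: a_def)
qed

text \<open>Testing with the conjugates of a_0, ..., a_n, and with u the phase of a_N, aligns all
  terms on the left. The test bound becomes |a_N| + 2S \<le> 1 + S; since N > 2n there is no
  quadratic term.\<close>

lemma class_B_coeff_bound: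
  assumes f: "f \<in> class_B" and N: "2 * n < N"
  shows "norm (taylor_coeff f N) \<le> 1 - (\<Sum>k\<le>n. (norm (taylor_coeff f k))\<^sup>2)"
proof -
  define a where "a = taylor_coeff f"
  \<comment> \<open>As sgn 0 = 0 is not unimodular, u is set to 1 when a_N vanishes.\<close>
  define u where "u = (if a N = 0 then 1 else sgn (a N))"
  define S where "S = (\<Sum>k\<le>n. (norm (a k))\<^sup>2)"
  have u: "norm u = 1" "a N = u * norm (a N)"
    by (simp add: u_def norm_sgn) (simp add: u_def sgn_div_norm scaleR_conv_of_real)
  have "(\<Sum>k\<le>n. a k * cnj (a k)) = of_real S"
    by (simp add: S_def complex_norm_square del: of_real_power)
  hence "norm (a N + 2 * u * of_real S) \<le> 1 + S"
    using class_B_coeff_test_bound[OF f, of n N u "\<lambda>k. cnj (a k)"] N u(1) by (simp add: a_def S_def)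
  also have "a N + 2 * u * of_real S = u * of_real (norm (a N) + 2 * S)"
    by (subst u(2)) (simp add: algebra_simps)
  also have "norm \<dots> = norm (a N) + 2 * S"
    unfolding norm_mult u(1) norm_of_real by (simp add: S_def sum_nonneg)
  finally show ?thesis by (simp add: a_def S_def)
qed

text \<open>For N = 2n the quadratic term is present and may oppose the others, so it is subtracted
  in modulus. Only w_n enters it, hence only the middle weight is rescaled.\<close>

lemma class_B_coeff_bound_even:
  assumes f: "f \<in> class_B" and n: "1 \<le> n"
  defines "b \<equiv> \<lambda>k. norm (taylor_coeff f k)"
  shows "b (2 * n) \<le> 1 - (\<Sum>k<n. (b k)\<^sup>2) - (b n)\<^sup>2 / (1 + b 0)"
proof -
  define a where "a = taylor_coeff f"
  define N where "N = 2 * n"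
  define u where "u = (if a N = 0 then 1 else sgn (a N))"
  define S where "S = (\<Sum>k<n. (b k)\<^sup>2)"
  \<comment> \<open>This value maximises 2\<beta> - (1 + b_0) \<beta>^2, the net factor of b_n^2 in
    the resulting estimate; the maximum is \<beta> itself.\<close>
  define \<beta> where "\<beta> = 1 / (1 + b 0)"
  define w where "w k = (if k = n then of_real \<beta> else 1) * cnj (a k)" for k
  have ba: "b k = norm (a k)" for k by (simp add: b_def a_def)
  have b0: "b 0 \<ge> 0" by (simp add: b_def)
  have u: "norm u = 1" "a N = u * norm (a N)"
    by (simp add: u_def norm_sgn) (simp add: u_def sgn_div_norm scaleR_conv_of_real)
  have s: "{..n} = insert n {..<n}" by auto
  have sum1: "(\<Sum>k\<le>n. a k * w k) = of_real (\<beta> * (b n)\<^sup>2 + S)"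
    by (simp add: s w_def S_def ba complex_norm_square mult_ac del: of_real_power)
  have sum2: "(\<Sum>k\<le>n. (norm (w k))\<^sup>2) = \<beta>\<^sup>2 * (b n)\<^sup>2 + S"
    by (simp add: s w_def S_def ba norm_mult power_mult_distrib)
  have "norm (u * of_real (b N + 2 * (\<beta> * (b n)\<^sup>2 + S)) + u\<^sup>2 * a 0 * (w n)\<^sup>2) \<le> 1 + (\<beta>\<^sup>2 * (b n)\<^sup>2 + S)"
  proof -
    have "u * of_real (b N + 2 * (\<beta> * (b n)\<^sup>2 + S)) = a N + 2 * u * (\<Sum>k\<le>n. a k * w k)"
      unfolding sum1 by (subst u(2)) (simp add: ba algebra_simps)
    thus ?thesis
      using class_B_coeff_test_bound[OF f, of n N u w] n u(1) unfolding sum2 by (simp add: a_def N_def)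
  qed
  moreover have "norm (u * of_real (b N + 2 * (\<beta> * (b n)\<^sup>2 + S))) = b N + 2 * (\<beta> * (b n)\<^sup>2 + S)"
    unfolding norm_mult u(1) norm_of_real using b0 by (simp add: S_def sum_nonneg \<beta>_def b_def)
  moreover have "norm (u\<^sup>2 * a 0 * (w n)\<^sup>2) = b 0 * \<beta>\<^sup>2 * (b n)\<^sup>2"
    using u(1) by (simp add: norm_mult norm_power w_def ba power_mult_distrib)
  ultimately have "b N + 2 * (\<beta> * (b n)\<^sup>2 + S) - b 0 * \<beta>\<^sup>2 * (b n)\<^sup>2 \<le> 1 + (\<beta>\<^sup>2 * (b n)\<^sup>2 + S)"
    using norm_diff_ineq[of "u * of_real (b N + 2 * (\<beta> * (b n)\<^sup>2 + S))" "u\<^sup>2 * a 0 * (w n)\<^sup>2"] by linarith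
  moreover have "\<beta>\<^sup>2 * (b n)\<^sup>2 + b 0 * \<beta>\<^sup>2 * (b n)\<^sup>2 = (1 + b 0) * \<beta> * (\<beta> * (b n)\<^sup>2)"
    by (simp add: algebra_simps power2_eq_square)
  moreover have "(1 + b 0) * \<beta> = 1" using b0 by (simp add: \<beta>_def)
  ultimately have "b N \<le> 1 - S - \<beta> * (b n)\<^sup>2" by simp
  thus ?thesis by (simp add: N_def S_def \<beta>_def)
qed

subsection \<open>The bound for \<open>B\<^sub>1 + A\<close>\<close>

lemma class_F_nonneg: "\<phi> \<in> class_F \<Longrightarrow> r \<in> {0..<1} \<Longrightarrow> 0 \<le> \<phi> n r"
  by (simp add: class_F_def)

lemma class_F_summable:
  assumes "\<phi> \<in> class_F" and r: "r \<in> {0..<1}"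
  shows "summable (\<lambda>n. \<phi> n r)"
proof -
  obtain d where d: "d > 0" "uniformly_convergent_on (ball r d \<inter> {0..<1}) (\<lambda>N r. \<Sum>n<N. \<phi> n r)"
    using assms unfolding class_F_def by blast
  have "convergent (\<lambda>N. \<Sum>n<N. \<phi> n r)"
    using uniformly_convergent_imp_convergent[OF d(2), of r] r d(1) by auto
  thus ?thesis by (simp add: summable_iff_convergent)
qed

lemma tail_sum_nonneg:
  assumes "\<phi> \<in> class_F" "r \<in> {0..<1}"
  shows "0 \<le> tail_sum \<phi> N r"
  unfolding tail_sum_def
  by (intro suminf_nonneg summable_ignore_initial_segment class_F_summable class_F_nonneg assms)

lemma tail_sum_sums:
  assumes "\<phi> \<in> class_F" "r \<in> {0..<1}"
  shows "(\<lambda>n. \<phi> (n + N) r) sums tail_sum \<phi> N r"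
  unfolding tail_sum_def
  by (intro summable_sums summable_ignore_initial_segment class_F_summable assms)

text \<open>The weight with which \<open>\<bar>a\<^sub>k\<bar>\<^sup>2\<close> enters the Carlson-type bound for \<open>\<bar>a\<^sub>i\<bar>\<close>; as a function of
  \<open>i\<close> it is also the weight of \<open>\<phi>\<^sub>i\<close> in the \<open>k\<close>-th summand of \<open>A(f\<^sub>0, \<phi>, r)\<close>.\<close>

definition carlson_weight :: "real \<Rightarrow> nat \<Rightarrow> nat \<Rightarrow> real" where
  "carlson_weight b k i = (if i = 2 * k then 1 / (1 + b) else if 2 * k < i then 1 else 0)"

text \<open>Both parities of Carlson's inequality in one form, with the k = 0 term moved to the
  right. The weight vanishes for 2k > i, so the cut-off \<open>K\<close> can be arbitrary and
  independent of \<open>i\<close>, which allows summation over \<open>i\<close> afterwards.\<close>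

lemma class_B_coeff_weight_bound:
  fixes f
  defines "b \<equiv> \<lambda>k. norm (taylor_coeff f k)"
  assumes f: "f \<in> class_B" and i: "1 \<le> i"
  shows "b i + (\<Sum>k<K. (b (Suc k))\<^sup>2 * carlson_weight (b 0) (Suc k) i) \<le> 1 - (b 0)\<^sup>2"
proof -
  let ?g = "\<lambda>k. (b (Suc k))\<^sup>2 * carlson_weight (b 0) (Suc k) i"
  have g: "?g k \<ge> 0" for k by (simp add: carlson_weight_def b_def)
  have "sum ?g {..<K} = sum ?g ({..<K} \<inter> {..<i div 2})"
    by (rule sum.mono_neutral_right) (auto simp: carlson_weight_def)
  also have "\<dots> \<le> sum ?g {..<i div 2}"
    by (rule sum_mono2) (use g in auto)
  finally have le: "sum ?g {..<K} \<le> sum ?g {..<i div 2}" .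
  show ?thesis
  proof (cases "even i")
    case True
    with i obtain m where m: "i = 2 * Suc m"
      by (metis evenE mult_0_right not0_implies_Suc not_one_le_zero)
    have "sum ?g {..<i div 2} = (\<Sum>k<m. (b (Suc k))\<^sup>2) + (b (Suc m))\<^sup>2 / (1 + b 0)"
      by (simp add: m carlson_weight_def)
    moreover have "(\<Sum>k<Suc m. (b k)\<^sup>2) = (b 0)\<^sup>2 + (\<Sum>k<m. (b (Suc k))\<^sup>2)"
      by (rule sum.lessThan_Suc_shift)
    ultimately show ?thesis
      using class_B_coeff_bound_even[OF f, of "Suc m"] le by (simp add: b_def m)
  next
    case False
    then obtain m where m: "i = 2 * m + 1" by (auto elim: oddE)
    have "sum ?g {..<i div 2} = (\<Sum>k<m. (b (Suc k))\<^sup>2)"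
      by (simp add: m carlson_weight_def)
    moreover have "(\<Sum>k<Suc m. (b k)\<^sup>2) = (b 0)\<^sup>2 + (\<Sum>k<m. (b (Suc k))\<^sup>2)"
      by (rule sum.lessThan_Suc_shift)
    ultimately show ?thesis
      using class_B_coeff_bound[OF f, of m i] le by (simp add: b_def m lessThan_Suc_atMost)
  qed
qed

text \<open>The weight splits into an isolated term at index 2k and a step function starting at 2k +
  1, whose series is a tail sum. With the shift by \<open>Suc\<close> these positions become 2k - 1
  and 2k.\<close>

lemma carlson_weight_sums:
  assumes "\<phi> \<in> class_F" "r \<in> {0..<1}" and k: "1 \<le> k"
  shows "(\<lambda>i. carlson_weight b k (Suc i) * \<phi> (Suc i) r) sums
    (\<phi> (2 * k) r / (1 + b) + tail_sum \<phi> (2 * k + 1) r)"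
proof -
  let ?g = "\<lambda>i. if 2 * k \<le> i then \<phi> (Suc i) r else 0"
  have "?g sums (tail_sum \<phi> (2 * k + 1) r + (\<Sum>i<2 * k. ?g i))"
    by (subst sums_iff_shift'[of _ "2 * k", symmetric])
       (use tail_sum_sums[OF assms(1,2), of "2 * k + 1"] in simp)
  hence "?g sums tail_sum \<phi> (2 * k + 1) r" by simp
  moreover have "(\<lambda>i. if i = 2 * k - 1 then \<phi> (Suc i) r / (1 + b) else 0) sums
      (\<phi> (Suc (2 * k - 1)) r / (1 + b))"
    by (rule sums_single)
  ultimately have "(\<lambda>i. (if i = 2 * k - 1 then \<phi> (Suc i) r / (1 + b) else 0) + ?g i) sums
      (\<phi> (Suc (2 * k - 1)) r / (1 + b) + tail_sum \<phi> (2 * k + 1) r)"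
    by (intro sums_add)
  moreover have "(\<lambda>i. (if i = 2 * k - 1 then \<phi> (Suc i) r / (1 + b) else 0) + ?g i)
      = (\<lambda>i. carlson_weight b k (Suc i) * \<phi> (Suc i) r)"
    using k by (auto simp: carlson_weight_def fun_eq_iff)
  ultimately show ?thesis using k by simp
qed

text \<open>The coefficient bounds are multiplied by \<open>\<phi> i r\<close> and summed over i
  \<ge> 1, then the sums over i and k are interchanged. The first two facts serve the sharpness
  argument, the third the inequality.\<close>

lemma class_B_B1_A_bound:
  assumes f: "f \<in> class_B" and \<phi>: "\<phi> \<in> class_F" and r: "r \<in> {0..<1}"
  shows summable_B1: "summable (\<lambda>n. norm (taylor_coeff f (Suc n)) * \<phi> (Suc n) r)"
    and A_sum_nonneg: "0 \<le> A_sum f \<phi> r"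
    and B1_sum_plus_A_sum_le:
      "B1_sum f \<phi> r + A_sum f \<phi> r \<le> (1 - (norm (f 0))\<^sup>2) * tail_sum \<phi> 1 r"
proof -
  define b where "b k = norm (taylor_coeff f k)" for k
  note Carlson = class_B_coeff_weight_bound[OF f, folded b_def]
  define h where "h k = (b (Suc k))\<^sup>2 * (\<phi> (2 * Suc k) r / (1 + b 0) + tail_sum \<phi> (2 * Suc k + 1) r)" for k
  have c: "0 \<le> \<phi> n r" for n using class_F_nonneg[OF \<phi> r] .
  have \<Phi>: "(\<lambda>i. \<phi> (Suc i) r) sums tail_sum \<phi> 1 r"
    using tail_sum_sums[OF \<phi> r, of 1] by simp
  have b1: "b (Suc i) \<le> 1" for i
    using Carlson[of "Suc i" 0] by (simp add: order_trans[of _ "1 - (b 0)\<^sup>2"])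
  have sB: "summable (\<lambda>i. b (Suc i) * \<phi> (Suc i) r)"
    by (rule summable_comparison_test'[OF sums_summable[OF \<Phi>]])
       (use b1 c in \<open>auto simp: abs_mult b_def intro: mult_left_le_one_le\<close>)
  thus "summable (\<lambda>n. norm (taylor_coeff f (Suc n)) * \<phi> (Suc n) r)" by (simp add: b_def)
  have B: "(\<lambda>i. b (Suc i) * \<phi> (Suc i) r) sums B1_sum f \<phi> r"
    using summable_sums[OF sB] by (simp add: B1_sum_def b_def)
  \<comment> \<open>Cutting the sum over k at \<open>K\<close> makes the interchange a finite sum of
    convergent series. The bound is uniform in \<open>K\<close>, so it also yields the convergence
    of A.\<close>
  have le: "B1_sum f \<phi> r + sum h {..<K} \<le> (1 - (b 0)\<^sup>2) * tail_sum \<phi> 1 r" for K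
  proof -
    have "(\<lambda>i. b (Suc i) * \<phi> (Suc i) r + (\<Sum>k<K. (b (Suc k))\<^sup>2 *
        (carlson_weight (b 0) (Suc k) (Suc i) * \<phi> (Suc i) r))) sums (B1_sum f \<phi> r + sum h {..<K})"
      unfolding h_def by (intro sums_add sums_sum sums_mult carlson_weight_sums B \<phi> r) simp
    moreover have "(\<lambda>i. (1 - (b 0)\<^sup>2) * \<phi> (Suc i) r) sums ((1 - (b 0)\<^sup>2) * tail_sum \<phi> 1 r)"
      by (intro sums_mult \<Phi>)
    moreover have "b (Suc i) * \<phi> (Suc i) r + (\<Sum>k<K. (b (Suc k))\<^sup>2 *
        (carlson_weight (b 0) (Suc k) (Suc i) * \<phi> (Suc i) r)) \<le> (1 - (b 0)\<^sup>2) * \<phi> (Suc i) r" for i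
      using mult_right_mono[OF Carlson[of "Suc i" K] c[of "Suc i"]]
      by (simp add: algebra_simps sum_distrib_left)
    ultimately show ?thesis by (rule sums_le[rotated])
  qed
  have h: "0 \<le> h k" for k
    unfolding h_def b_def by (intro mult_nonneg_nonneg add_nonneg_nonneg divide_nonneg_nonneg
        tail_sum_nonneg c \<phi> r) auto
  have sh: "summable h"
    by (rule summableI_nonneg_bounded[OF h, where x = "(1 - (b 0)\<^sup>2) * tail_sum \<phi> 1 r - B1_sum f \<phi> r"])
       (use le in \<open>simp add: algebra_simps\<close>)
  have A: "A_sum f \<phi> r = suminf h"
    by (simp add: A_sum_def h_def[abs_def] b_def)
  show "0 \<le> A_sum f \<phi> r"
    unfolding A by (rule suminf_nonneg[OF sh h])
  have "suminf h \<le> (1 - (b 0)\<^sup>2) * tail_sum \<phi> 1 r - B1_sum f \<phi> r"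
    by (rule suminf_le_const[OF sh]) (use le in \<open>simp add: algebra_simps\<close>)
  thus "B1_sum f \<phi> r + A_sum f \<phi> r \<le> (1 - (norm (f 0))\<^sup>2) * tail_sum \<phi> 1 r"
    by (simp add: A b_def taylor_coeff_0)
qed

subsection \<open>Schwarz and Schwarz--Pick bounds\<close>

text \<open>Schwarz's lemma for a zero of order m: divide out z^m, apply the maximum principle to
  the quotient on |w| \<le> \<rho>, and let \<rho> tend to 1.\<close>

lemma class_Bm_norm_le_power:
  assumes \<omega>: "\<omega> \<in> class_Bm m" and z: "norm z < 1"
  shows "norm (\<omega> z) \<le> norm z ^ m"
proof -
  have B: "\<omega> \<in> class_B" and van: "\<And>k. k < m \<Longrightarrow> (deriv ^^ k) \<omega> 0 = 0"
    using \<omega> by (auto simp: class_Bm_def)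
  let ?c = "\<lambda>n. (deriv ^^ n) \<omega> 0 / fact n"
  \<comment> \<open>The quotient is defined by the shifted Taylor series, which makes it holomorphic
    at 0 as well.\<close>
  define G where "G z = (\<Sum>n. ?c (n + m) * z ^ n)" for z
  have \<omega>G: "\<omega> w = w ^ m * G w" and Gs: "(\<lambda>n. ?c (n + m) * w ^ n) sums G w" if w: "norm w < 1" for w :: complex
  proof -
    have s: "(\<lambda>n. ?c n * w ^ n) sums \<omega> w"
      using holomorphic_power_series[OF class_B_holomorphic[OF B], of w] w by simp
    have z0: "(\<Sum>n<m. ?c n * w ^ n) = 0" using van by simp
    have s': "(\<lambda>n. w ^ m * (?c (n + m) * w ^ n)) sums \<omega> w"
      using sums_split_initial_segment[OF s, of m] z0 by (simp add: power_add mult_ac)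
    show 1: "(\<lambda>n. ?c (n + m) * w ^ n) sums G w"
    proof (cases "w = 0")
      case True
      then show ?thesis
        unfolding G_def using powser_sums_zero[of "\<lambda>n. ?c (n + m)"] by (simp add: sums_iff)
    next
      case False
      have "summable (\<lambda>n. w ^ m * (?c (n + m) * w ^ n))" using s' by (rule sums_summable)
      hence "summable (\<lambda>n. ?c (n + m) * w ^ n)"
        using False by (subst (asm) summable_cmult_iff) auto
      thus ?thesis unfolding G_def by (rule summable_sums)
    qed
    from sums_unique2[OF s' sums_mult[OF 1]] show "\<omega> w = w ^ m * G w" .
  qed
  have holG: "G holomorphic_on ball 0 1"
    by (rule power_series_holomorphic[of 0 1 "\<lambda>n. ?c (n + m)"]) (use Gs in auto)
  have le: "norm (G z) * \<rho> ^ m \<le> 1" if \<rho>: "norm z < \<rho>" "\<rho> < 1" for \<rho>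
  proof -
    have r0: "0 < \<rho>" using \<rho>(1) norm_ge_zero[of z] by linarith
    have "norm (G z) \<le> 1 / \<rho> ^ m"
    proof (rule maximum_modulus_frontier[of G "cball 0 \<rho>"])
      show "G holomorphic_on interior (cball 0 \<rho>)"
        by (rule holomorphic_on_subset[OF holG]) (use \<rho> in auto)
      show "continuous_on (closure (cball 0 \<rho>)) G"
        by (rule continuous_on_subset[OF holomorphic_on_imp_continuous_on[OF holG]]) (use \<rho> in auto)
      fix w :: complex assume "w \<in> frontier (cball 0 \<rho>)"
      hence w: "norm w = \<rho>" using r0 by (simp add: frontier_cball)
      have "\<rho> ^ m * norm (G w) \<le> 1"
        using \<omega>G[of w] class_B_norm_le[OF B, of w] w \<rho> by (simp add: norm_mult norm_power)
      thus "norm (G w) \<le> 1 / \<rho> ^ m" using r0 by (simp add: field_simps)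
    qed (use \<rho> in auto)
    thus ?thesis using r0 by (simp add: field_simps)
  qed
  have "((\<lambda>\<rho>. norm (G z) * \<rho> ^ m) \<longlongrightarrow> norm (G z) * 1 ^ m) (at_left 1)"
    by (intro tendsto_intros)
  moreover have "eventually (\<lambda>\<rho>. norm (G z) * \<rho> ^ m \<le> 1) (at_left (1::real))"
    using eventually_at_left_real[OF z] by (rule eventually_mono) (auto intro: le)
  ultimately have "norm (G z) \<le> 1"
    using tendsto_upperbound[of "\<lambda>\<rho>. norm (G z) * \<rho> ^ m"] by auto
  thus ?thesis
    unfolding \<omega>G[OF z] norm_mult norm_power by (intro mult_right_le_one_le) auto
qed

text \<open>Expresses |1 - cnj(w) z|^2 - |z - w|^2 = (1 - |w|^2)(1 - |z|^2) through the Moebius map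
  z \<mapsto> (z - w) / (1 - cnj(w) z).\<close>

lemma one_minus_norm_Moebius_square:
  assumes "norm w < 1" "norm z < 1"
  shows "(1 - (norm (Moebius_function 0 w z))\<^sup>2) * (norm (1 - cnj w * z))\<^sup>2
    = (1 - (norm w)\<^sup>2) * (1 - (norm z)\<^sup>2)"
proof -
  have "norm (cnj w * z) < 1"
    using assms mult_left_le[of "norm z" "norm w"] by (simp add: norm_mult)
  hence ne: "1 - cnj w * z \<noteq> 0" by auto
  have "complex_of_real ((norm (1 - cnj w * z))\<^sup>2 - (norm (z - w))\<^sup>2)
      = of_real ((1 - (norm w)\<^sup>2) * (1 - (norm z)\<^sup>2))"
    unfolding of_real_diff of_real_mult complex_norm_square by (simp add: algebra_simps)
  hence "(norm (1 - cnj w * z))\<^sup>2 - (norm (z - w))\<^sup>2 = (1 - (norm w)\<^sup>2) * (1 - (norm z)\<^sup>2)"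
    by (simp only: of_real_eq_iff)
  moreover have "(norm (Moebius_function 0 w z))\<^sup>2 * (norm (1 - cnj w * z))\<^sup>2 = (norm (z - w))\<^sup>2"
    using ne by (simp add: Moebius_function_simple norm_divide power_divide)
  ultimately show ?thesis by (simp add: algebra_simps)
qed

text \<open>Schwarz's lemma applies to f followed by the Moebius map taking f(0) to 0. This gives F
  \<le> (A + t) / (1 + A t) for the moduli \<open>A\<close>, \<open>F\<close>, \<open>t\<close> of
  f(0), f(w), w, from which the product form follows.\<close>

lemma Schwarz_Pick_norm_bound:
  assumes hol: "f holomorphic_on ball 0 1" and lt: "\<And>z. norm z < 1 \<Longrightarrow> norm (f z) < 1"
    and w: "norm w < 1"
  shows "(1 - (norm (f 0))\<^sup>2) * (1 - norm w) \<le> (1 - (norm (f w))\<^sup>2) * (1 + norm w)"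
proof -
  define a where "a = f 0"
  define A where "A = norm a"
  define F where "F = norm (f w)"
  define t where "t = norm w"
  have a: "norm a < 1" using lt[of 0] by (simp add: a_def)
  have A: "0 \<le> A" "A < 1" and F: "0 \<le> F" "F < 1" and t: "0 \<le> t" "t < 1"
    using a lt[OF w] w by (auto simp: A_def F_def t_def)
  define g where "g = Moebius_function 0 a \<circ> f"
  have holg: "g holomorphic_on ball 0 1"
    unfolding g_def
    by (rule holomorphic_on_compose_gen[OF hol Moebius_function_holomorphic[OF a]]) (use lt in auto)
  have "norm (g w) \<le> t"
    unfolding t_def
  proof (rule Schwarz_Lemma(1)[OF holg])
    show "g 0 = 0" by (simp add: g_def a_def Moebius_function_eq_zero)
    show "norm (g z) < 1" if "norm z < 1" for z
      using Moebius_function_norm_lt_1[OF a lt[OF that]] by (simp add: g_def)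
  qed (use w in auto)
  hence "(norm (g w))\<^sup>2 \<le> t\<^sup>2" by (simp add: power_mono)
  hence "(1 - t\<^sup>2) * (norm (1 - cnj a * f w))\<^sup>2 \<le> (1 - (norm (g w))\<^sup>2) * (norm (1 - cnj a * f w))\<^sup>2"
    by (intro mult_right_mono) auto
  also have "\<dots> = (1 - A\<^sup>2) * (1 - F\<^sup>2)"
    unfolding g_def o_def A_def F_def by (rule one_minus_norm_Moebius_square[OF a lt[OF w]])
  finally have 1: "(1 - t\<^sup>2) * (norm (1 - cnj a * f w))\<^sup>2 \<le> (1 - A\<^sup>2) * (1 - F\<^sup>2)" .
  have AF: "A * F < 1" using A F mult_strict_mono'[of A 1 F 1] by simp
  have "1 - A * F \<le> norm (1 - cnj a * f w)"
    using norm_triangle_ineq2[of 1 "cnj a * f w"] by (simp add: norm_mult A_def F_def)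
  hence "(1 - A * F)\<^sup>2 \<le> (norm (1 - cnj a * f w))\<^sup>2"
    using AF by (intro power_mono) auto
  hence "(1 - t\<^sup>2) * (1 - A * F)\<^sup>2 \<le> (1 - t\<^sup>2) * (norm (1 - cnj a * f w))\<^sup>2"
    using t by (intro mult_left_mono) (auto simp: power_le_one)
  with 1 have "(1 - t\<^sup>2) * (1 - A * F)\<^sup>2 \<le> (1 - A\<^sup>2) * (1 - F\<^sup>2)" by linarith
  \<comment> \<open>Uses (1 - A^2)(1 - F^2) = (1 - A F)^2 - (F - A)^2.\<close>
  hence "(F - A)\<^sup>2 \<le> (t * (1 - A * F))\<^sup>2"
    by (simp add: power2_eq_square algebra_simps)
  hence "F - A \<le> t * (1 - A * F)"
    using AF t by (intro power2_le_imp_le[of "F - A"]) auto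
  hence F_le: "F \<le> (A + t) / (1 + A * t)"
    using A t by (simp add: field_simps add_pos_nonneg)
  have pos: "0 < 1 + A * t" using A t by (simp add: add_pos_nonneg)
  have "F\<^sup>2 \<le> ((A + t) / (1 + A * t))\<^sup>2" using F_le F by (intro power_mono) auto
  hence "F\<^sup>2 * (1 + A * t)\<^sup>2 \<le> (A + t)\<^sup>2" using pos by (simp add: power_divide field_simps)
  \<comment> \<open>Uses (1 + A t)^2 - (A + t)^2 = (1 - A^2)(1 - t^2). Next, A \<le> 1 replaces 1 +
    A t by 1 + t, one factor of which then cancels.\<close>
  hence "(1 - A\<^sup>2) * (1 - t\<^sup>2) \<le> (1 - F\<^sup>2) * (1 + A * t)\<^sup>2"
    by (simp add: power2_eq_square algebra_simps)
  also have "\<dots> \<le> (1 - F\<^sup>2) * (1 + t)\<^sup>2"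
    using F A t pos by (intro mult_left_mono power_mono) (auto simp: power_le_one mult_left_le_one_le)
  finally have "((1 - A\<^sup>2) * (1 - t)) * (1 + t) \<le> ((1 - F\<^sup>2) * (1 + t)) * (1 + t)"
    by (simp add: power2_eq_square algebra_simps)
  hence "(1 - A\<^sup>2) * (1 - t) \<le> (1 - F\<^sup>2) * (1 + t)"
    using t by (subst (asm) mult_le_cancel_right_pos) auto
  thus ?thesis by (simp add: A_def F_def t_def a_def)
qed

text \<open>A member of \<open>class_B\<close> may attain modulus 1, so the strict version is
  applied to s f with 0 < s < 1, and s tends to 1.\<close>

lemma class_B_Schwarz_Pick:
  assumes f: "f \<in> class_B" and w: "norm w < 1"
  shows "(1 - (norm (f 0))\<^sup>2) * (1 - norm w) \<le> (1 - (norm (f w))\<^sup>2) * (1 + norm w)"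
proof -
  have le: "(1 - (s * norm (f 0))\<^sup>2) * (1 - norm w) \<le> (1 - (s * norm (f w))\<^sup>2) * (1 + norm w)"
    if s: "0 < s" "s < 1" for s :: real
  proof -
    have lt: "norm (of_real s * f z) < 1" if z: "norm z < 1" for z
    proof -
      have "norm (of_real s * f z) \<le> s * 1"
        unfolding norm_mult using s class_B_norm_le[OF f z] by (intro mult_mono) auto
      thus ?thesis using s by linarith
    qed
    have "(\<lambda>z. of_real s * f z) holomorphic_on ball 0 1"
      by (intro holomorphic_intros class_B_holomorphic f)
    from Schwarz_Pick_norm_bound[OF this lt w] show ?thesis
      using s by (simp add: norm_mult)
  qed
  have "eventually (\<lambda>s. (1 - (s * norm (f 0))\<^sup>2) * (1 - norm w) \<le> (1 - (s * norm (f w))\<^sup>2) * (1 + norm w))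
      (at_left (1::real))"
    using eventually_at_left_real[of 0 "1::real", OF zero_less_one] by (rule eventually_mono) (auto intro: le)
  moreover have "((\<lambda>s. (1 - (s * norm (f 0))\<^sup>2) * (1 - norm w)) \<longlongrightarrow> (1 - (1 * norm (f 0))\<^sup>2) * (1 - norm w))
      (at_left (1::real))"
    by (intro tendsto_intros)
  moreover have "((\<lambda>s. (1 - (s * norm (f w))\<^sup>2) * (1 + norm w)) \<longlongrightarrow> (1 - (1 * norm (f w))\<^sup>2) * (1 + norm w))
      (at_left (1::real))"
    by (intro tendsto_intros)
  ultimately have "(1 - (1 * norm (f 0))\<^sup>2) * (1 - norm w) \<le> (1 - (1 * norm (f w))\<^sup>2) * (1 + norm w)"
    by (intro tendsto_le[OF trivial_limit_at_left_real])
  thus ?thesis by simp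
qed

text \<open>Convexity of exp between 0 and 2 ln t with weights 1 - p/2 and p/2, which are
  nonnegative because p \<le> 2.\<close>

lemma powr_le_affine_square:
  fixes t p :: real
  assumes t: "0 \<le> t" and p: "0 < p" "p \<le> 2"
  shows "t powr p \<le> 1 - p / 2 * (1 - t\<^sup>2)"
proof (cases "t = 0")
  case True
  thus ?thesis using p by simp
next
  case False
  hence t: "t > 0" using t by simp
  have "exp ((1 - p / 2) *\<^sub>R 0 + (p / 2) *\<^sub>R (2 * ln t)) \<le> (1 - p / 2) * exp 0 + (p / 2) * exp (2 * ln t)"
    using p by (intro convex_onD[OF exp_convex]) auto
  moreover have "exp (2 * ln t) = t\<^sup>2" using t by (simp add: exp_double)
  ultimately show ?thesis using t by (simp add: powr_def algebra_simps)
qed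

subsection \<open>The Bohr inequality and its sharpness\<close>

lemma taylor_coeff_eqI:
  assumes "f \<in> class_B" "f has_fps_expansion F"
  shows "taylor_coeff f n = fps_nth F n"
  using fps_nth_fps_expansion[OF class_B_has_fps_expansion[OF assms(1)], of n]
    fps_nth_fps_expansion[OF assms(2), of n] by simp

lemma Moebius_function_class_B:
  assumes "norm w < 1"
  shows "Moebius_function 0 w \<in> class_B"
  unfolding class_B_def
  using Moebius_function_norm_lt_1[OF assms, of _ 0] Moebius_function_holomorphic[OF assms, of 0]
  by (auto simp: analytic_on_open less_imp_le)

text \<open>Multiply the geometric series of 1 / (1 - a z) by z - a: the coefficient is a^n - a
  a^(n+1).\<close>

lemma taylor_coeff_Moebius_function_Suc:
  fixes a :: real
  assumes "\<bar>a\<bar> < 1"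
  shows "taylor_coeff (Moebius_function 0 (of_real a)) (Suc n) = of_real ((1 - a\<^sup>2) * a ^ n)"
proof -
  let ?c = "fps_const (complex_of_real a)"
  let ?G = "Abs_fps (\<lambda>k. complex_of_real a ^ k)"
  have "(\<lambda>z. (z - of_real a) * inverse (1 - of_real a * z)) has_fps_expansion
      (fps_X - ?c) * inverse (1 - ?c * fps_X)"
    by (intro fps_expansion_intros) simp
  also have "inverse (1 - ?c * fps_X) = ?G"
    using one_minus_const_fps_X_neg_power'[of 1 "complex_of_real a"] by simp
  also have "(\<lambda>z. (z - of_real a) * inverse (1 - of_real a * z)) = Moebius_function 0 (of_real a)"
    by (simp add: fun_eq_iff Moebius_function_simple divide_inverse)
  finally have "taylor_coeff (Moebius_function 0 (of_real a)) (Suc n)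
      = fps_nth ((fps_X - ?c) * ?G) (Suc n)"
    using assms by (intro taylor_coeff_eqI Moebius_function_class_B) auto
  also have "\<dots> = of_real a ^ n - of_real a * of_real a ^ Suc n"
    by (simp add: algebra_simps)
  finally show ?thesis by (simp add: algebra_simps power2_eq_square)
qed

text \<open>The sign sends r to the side opposite to a > 0, where z \<mapsto> (z - a) / (1 - a z)
  attains the Schwarz-Pick bound (a + r^m) / (1 + a r^m).\<close>

lemma minus_power_class_Bm:
  assumes "m \<ge> 1"
  shows "(\<lambda>z. - (z ^ m)) \<in> class_Bm m"
proof -
  have exp: "(\<lambda>z. - (z ^ m)) has_fps_expansion (- (fps_X ^ m :: complex fps))"
    by (intro fps_expansion_intros)
  have "(deriv ^^ k) (\<lambda>z. - (z ^ m)) 0 = (if k = m then - fact m else (0::complex))" for k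
    using fps_nth_fps_expansion[OF exp, of k]
    by (auto simp: fps_X_power_nth field_simps split: if_splits)
  moreover have "(\<lambda>z::complex. - (z ^ m)) \<in> class_B"
    unfolding class_B_def
    by (auto simp: norm_power analytic_on_open power_le_one intro!: holomorphic_intros)
  ultimately show ?thesis by (simp add: class_Bm_def)
qed

text \<open>The first term falls short of \<open>\<phi> 0 r\<close> by at least (1 - A^2) p \<kappa>
  \<open>\<phi> 0 r\<close> / 2, while B_1 + A is at most (1 - A^2)
  \<open>tail_sum \<phi> 1 r\<close>. After removal of the common factor, \<open>Psi1\<close> \<ge>
  0 at this r is the required comparison.\<close>

lemma A_fun_le:
  assumes p: "p \<in> {0<..2}" and \<phi>: "\<phi> \<in> class_F" and f: "f \<in> class_B" and \<omega>: "\<omega> \<in> class_Bm m"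
    and m: "m \<ge> 1" and z: "norm z < 1" and Psi: "0 \<le> Psi1 m p \<phi> (norm z)"
  shows "A_fun f \<omega> p \<phi> z \<le> \<phi> 0 (norm z)"
proof -
  define r where "r = norm z"
  define \<rho> where "\<rho> = r ^ m"
  define \<kappa> where "\<kappa> = (1 - \<rho>) / (1 + \<rho>)"
  define t where "t = norm (\<omega> z)"
  define A where "A = norm (f 0)"
  define F where "F = norm (f (\<omega> z))"
  have r: "r \<in> {0..<1}" using z by (simp add: r_def)
  have \<phi>0: "0 \<le> \<phi> 0 r" by (rule class_F_nonneg[OF \<phi> r])
  have t\<rho>: "t \<le> \<rho>" using class_Bm_norm_le_power[OF \<omega> z] by (simp add: t_def \<rho>_def r_def)
  have \<rho>: "0 \<le> \<rho>" "\<rho> < 1" using r m by (auto simp: \<rho>_def power_less_one_iff)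
  have t: "0 \<le> t" "t < 1" using t\<rho> \<rho> by (auto simp: t_def)
  have A: "0 \<le> 1 - A\<^sup>2"
    using class_B_norm_le[OF f, of 0] by (simp add: A_def power_le_one)
  have "(1 - A\<^sup>2) * (1 - t) \<le> (1 - F\<^sup>2) * (1 + t)"
    using class_B_Schwarz_Pick[OF f, of "\<omega> z"] t by (simp add: A_def F_def t_def)
  hence "(1 - A\<^sup>2) * ((1 - t) / (1 + t)) \<le> 1 - F\<^sup>2"
    using t by (simp add: field_simps)
  \<comment> \<open>(1 - x) / (1 + x) decreases in x, and t \<le> \<rho> by Schwarz's lemma.\<close>
  moreover have "\<kappa> \<le> (1 - t) / (1 + t)"
    using t\<rho> t \<rho> unfolding \<kappa>_def by (simp add: field_simps)
  ultimately have "(1 - A\<^sup>2) * \<kappa> \<le> 1 - F\<^sup>2"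
    using A by (meson mult_left_mono order_trans)
  hence "p / 2 * ((1 - A\<^sup>2) * \<kappa>) \<le> p / 2 * (1 - F\<^sup>2)"
    using p by (intro mult_left_mono) auto
  hence "F powr p \<le> 1 - p / 2 * ((1 - A\<^sup>2) * \<kappa>)"
    using powr_le_affine_square[of F p] p unfolding F_def greaterThanAtMost_iff
    by (meson diff_left_mono norm_ge_zero order_trans)
  hence "F powr p * \<phi> 0 r \<le> (1 - p / 2 * ((1 - A\<^sup>2) * \<kappa>)) * \<phi> 0 r"
    using \<phi>0 by (rule mult_right_mono)
  also have "\<dots> = \<phi> 0 r - (1 - A\<^sup>2) * (p * \<kappa> * \<phi> 0 r) / 2"
    by (simp add: field_simps)
  also have "\<dots> \<le> \<phi> 0 r - (1 - A\<^sup>2) * (2 * tail_sum \<phi> 1 r) / 2"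
  proof -
    have "2 * tail_sum \<phi> 1 r \<le> p * \<kappa> * \<phi> 0 r"
      using Psi by (simp add: Psi1_def r_def \<rho>_def \<kappa>_def)
    from mult_left_mono[OF this A] show ?thesis by simp
  qed
  finally show ?thesis
    using B1_sum_plus_A_sum_le[OF f \<phi> r] unfolding A_fun_def F_def A_def r_def by simp
qed

text \<open>Dropping A \<ge> 0 and truncating B_1 bounds \<open>A_fun\<close> below by a function
  g(a) with g(1) = \<open>\<phi> 0 r\<close> and g'(1) < 0, so g exceeds \<open>\<phi> 0 r\<close>
  just to the left of 1.\<close>

lemma A_fun_Moebius_gt:
  assumes p: "p \<in> {0<..2}" and \<phi>: "\<phi> \<in> class_F" and m: "m \<ge> 1"
    and r: "0 < r" "r < 1" and Psi: "Psi1 m p \<phi> r < 0"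
  obtains a where "0 < a" "a < 1"
    "\<phi> 0 r < A_fun (Moebius_function 0 (of_real a)) (\<lambda>z. - (z ^ m)) p \<phi> (of_real r)"
proof -
  define \<rho> where "\<rho> = r ^ m"
  define \<kappa> where "\<kappa> = (1 - \<rho>) / (1 + \<rho>)"
  have \<rho>: "0 < \<rho>" "\<rho> < 1" using r m by (auto simp: \<rho>_def power_less_one_iff)
  have r': "r \<in> {0..<1}" using r by simp
  have "(\<lambda>N. \<Sum>i<N. \<phi> (Suc i) r) \<longlonglongrightarrow> tail_sum \<phi> 1 r"
    using tail_sum_sums[OF \<phi> r', of 1] by (simp add: sums_def)
  moreover have "p * \<kappa> * \<phi> 0 r / 2 < tail_sum \<phi> 1 r"
  proof -
    have "Psi1 m p \<phi> r = p * \<kappa> * \<phi> 0 r - 2 * tail_sum \<phi> 1 r"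
      by (simp add: Psi1_def \<kappa>_def \<rho>_def)
    thus ?thesis using Psi by linarith
  qed
  \<comment> \<open>\<open>Psi1\<close> < 0 is strict, so a finite partial sum of the tail already
    suffices; \<open>g\<close> is then a finite sum and can be differentiated termwise.\<close>
  ultimately have "eventually (\<lambda>N. p * \<kappa> * \<phi> 0 r / 2 < (\<Sum>i<N. \<phi> (Suc i) r)) sequentially"
    by (rule order_tendstoD)
  then obtain N where N: "p * \<kappa> * \<phi> 0 r / 2 < (\<Sum>i<N. \<phi> (Suc i) r)"
    by (auto simp: eventually_sequentially)
  define g where "g a = ((a + \<rho>) / (1 + a * \<rho>)) powr p * \<phi> 0 r + (1 - a\<^sup>2) * (\<Sum>i<N. a ^ i * \<phi> (Suc i) r)" for a
  have d1: "((\<lambda>a. (a + \<rho>) / (1 + a * \<rho>)) has_real_derivative \<kappa>) (at 1)"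
  proof -
    have "(1 + \<rho>) * (1 - \<rho>) / ((1 + \<rho>) * (1 + \<rho>)) = \<kappa>"
      unfolding \<kappa>_def by (rule mult_divide_mult_cancel_left) (use \<rho> in auto)
    thus ?thesis
      using \<rho> by (auto intro!: derivative_eq_intros simp: algebra_simps)
  qed
  have "((\<lambda>a. ((a + \<rho>) / (1 + a * \<rho>)) powr p) has_real_derivative p * \<kappa>) (at 1)"
    using DERIV_fun_powr[OF d1, of p] \<rho> by (simp add: add.commute)
  moreover have "((\<lambda>a. (1 - a\<^sup>2) * (\<Sum>i<N. a ^ i * \<phi> (Suc i) r)) has_real_derivative
      - 2 * (\<Sum>i<N. \<phi> (Suc i) r)) (at 1)"
    by (auto intro!: derivative_eq_intros)
  ultimately have "(g has_real_derivative p * \<kappa> * \<phi> 0 r + - 2 * (\<Sum>i<N. \<phi> (Suc i) r)) (at 1)"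
    unfolding g_def by (intro DERIV_add DERIV_cmult_right)
  from DERIV_neg_dec_left[OF this] N
  obtain d where d: "d > 0" "\<And>h. h > 0 \<Longrightarrow> h < d \<Longrightarrow> g 1 < g (1 - h)"
    by auto
  \<comment> \<open>The minimum with 1 keeps a positive; the half puts 1 - a strictly below
    d.\<close>
  define a where "a = 1 - min d 1 / 2"
  have a: "0 < a" "a < 1" using d(1) by (auto simp: a_def)
  have "g 1 < g a" unfolding a_def using d(1) by (intro d(2)) auto
  moreover have "g 1 = \<phi> 0 r" using \<rho> by (simp add: g_def add.commute)
  moreover have "g a \<le> A_fun (Moebius_function 0 (of_real a)) (\<lambda>z. - (z ^ m)) p \<phi> (of_real r)"
  proof -
    let ?M = "Moebius_function 0 (of_real a)"
    have M: "?M \<in> class_B" using a by (intro Moebius_function_class_B) simp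
    have a2: "a\<^sup>2 < 1" using a by (simp add: power_less_one_iff)
    have "(\<Sum>i<N. norm (taylor_coeff ?M (Suc i)) * \<phi> (Suc i) r) \<le> B1_sum ?M \<phi> r"
      unfolding B1_sum_def
      by (intro sum_le_suminf summable_B1[OF M \<phi> r'] mult_nonneg_nonneg class_F_nonneg[OF \<phi> r']) auto
    moreover have "norm (taylor_coeff ?M (Suc i)) = (1 - a\<^sup>2) * a ^ i" for i
      using a a2 by (subst taylor_coeff_Moebius_function_Suc) (auto simp: norm_mult norm_power simp del: of_real_mult of_real_power of_real_diff)
    ultimately have "(1 - a\<^sup>2) * (\<Sum>i<N. a ^ i * \<phi> (Suc i) r) \<le> B1_sum ?M \<phi> r"
      by (simp add: sum_distrib_left mult_ac)
    moreover have "norm (?M (- (of_real r ^ m))) = (a + \<rho>) / (1 + a * \<rho>)"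
    proof -
      have "?M (- (of_real r ^ m)) = of_real (- ((a + \<rho>) / (1 + a * \<rho>)))"
        by (simp add: Moebius_function_simple \<rho>_def minus_divide_left)
      thus ?thesis using a \<rho> by (simp only: norm_of_real) simp
    qed
    ultimately show ?thesis
      using A_sum_nonneg[OF M \<phi> r'] r by (simp add: A_fun_def g_def)
  qed
  ultimately show ?thesis using that[OF a] by simp
qed

theorem theorem1:
  fixes m :: nat and p :: real and \<phi> :: "nat \<Rightarrow> real \<Rightarrow> real" and R\<^sub>1 :: real
  assumes "m \<ge> 1"
    and "p \<in> {0<..2}"
    and "\<phi> \<in> class_F"
    and "minimal_positive_root (Psi1 m p \<phi>) R\<^sub>1"
  shows "((\<forall>r\<in>{0..R\<^sub>1}. Psi1 m p \<phi> r \<ge> 0) \<longrightarrow>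
            (\<forall>f\<in>class_B. \<forall>\<omega>\<in>class_Bm m. \<forall>z. norm z \<le> R\<^sub>1 \<longrightarrow>
               A_fun f \<omega> p \<phi> z \<le> \<phi> 0 (norm z))) \<and>
         ((\<exists>\<epsilon>>0. R\<^sub>1 + \<epsilon> \<le> 1 \<and> (\<forall>r\<in>{R\<^sub>1<..<R\<^sub>1 + \<epsilon>}. Psi1 m p \<phi> r < 0)) \<longrightarrow>
            (\<forall>R'\<in>{R\<^sub>1<..1}. \<exists>f\<in>class_B. \<exists>\<omega>\<in>class_Bm m. \<exists>z.
               norm z < R' \<and> A_fun f \<omega> p \<phi> z > \<phi> 0 (norm z)))"
proof (intro conjI impI ballI allI)
  have R1: "0 < R\<^sub>1" "R\<^sub>1 < 1" using assms(4) by (auto simp: minimal_positive_root_def)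
  {
    fix f \<omega> and z :: complex
    assume "\<forall>r\<in>{0..R\<^sub>1}. 0 \<le> Psi1 m p \<phi> r" "f \<in> class_B" "\<omega> \<in> class_Bm m" "norm z \<le> R\<^sub>1"
    thus "A_fun f \<omega> p \<phi> z \<le> \<phi> 0 (norm z)"
      using R1 assms by (intro A_fun_le[where m = m]) auto
  next
    fix R'
    assume "\<exists>\<epsilon>>0. R\<^sub>1 + \<epsilon> \<le> 1 \<and> (\<forall>r\<in>{R\<^sub>1<..<R\<^sub>1 + \<epsilon>}. Psi1 m p \<phi> r < 0)" and R': "R' \<in> {R\<^sub>1<..1}"
    then obtain \<epsilon> where \<epsilon>: "\<epsilon> > 0" "R\<^sub>1 + \<epsilon> \<le> 1" "\<And>r. r \<in> {R\<^sub>1<..<R\<^sub>1 + \<epsilon>} \<Longrightarrow> Psi1 m p \<phi> r < 0"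
      by blast
    \<comment> \<open>Any such r lies where \<open>Psi1\<close> is negative and is still below R',
      so z = r is a counterexample point.\<close>
    obtain r where r: "R\<^sub>1 < r" "r < min R' (R\<^sub>1 + \<epsilon>)"
      using dense[of R\<^sub>1 "min R' (R\<^sub>1 + \<epsilon>)"] R' \<epsilon>(1) by auto
    with \<epsilon> R1 have r': "0 < r" "r < 1" "Psi1 m p \<phi> r < 0" by auto
    obtain a where a: "0 < a" "a < 1"
        "\<phi> 0 r < A_fun (Moebius_function 0 (of_real a)) (\<lambda>z. - (z ^ m)) p \<phi> (of_real r)"
      by (rule A_fun_Moebius_gt[OF assms(2,3,1) r'])
    show "\<exists>f\<in>class_B. \<exists>\<omega>\<in>class_Bm m. \<exists>z. norm z < R' \<and> A_fun f \<omega> p \<phi> z > \<phi> 0 (norm z)"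
    proof (intro bexI exI conjI)
      show "norm (complex_of_real r) < R'" using r r' by simp
      show "\<phi> 0 (norm (complex_of_real r))
          < A_fun (Moebius_function 0 (of_real a)) (\<lambda>z. - (z ^ m)) p \<phi> (of_real r)"
        using a r' by simp
      show "(\<lambda>z. - (z ^ m)) \<in> class_Bm m" using assms(1) by (rule minus_power_class_Bm)
      show "Moebius_function 0 (of_real a) \<in> class_B"
        using a by (intro Moebius_function_class_B) simp
    qed
  }
qed

end
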